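(* Let $\mathbb{X}=\mathbb{R}^{n}$ for some finite $n$, let $\mathbb{U}$ be a compact standard Borel space, and let $\mathcal{T}$ be a stochastic kernel from $\mathbb{X}\times\mathbb{U}$ to $\mathbb{X}$ (the true kernel). Suppose: (1) there exists $\beta\in[0,1)$ such that $\sup_{(x,u),(x',u')\in\mathbb{X}\times\mathbb{U}}\|\mathcal{T}(\cdot|x,u)-\mathcal{T}(\cdot|x',u')\|_{TV}\le 2\beta$; (2) there is a reference probability measure $\psi$ on $\mathbb{X}$ such that $\mathcal{T}(dy|x,u)=f_{x,u}(y)\psi(dy)$ for all $(x,u)$, and the densities $f_{x,u}(\cdot)$, $(x,u)\in\mathbb{X}\times\mathbb{U}$, form a bounded and equicontinuous family of functions; (3) for every stationary policy $\gamma\in\Gamma_S$ there exists a unique invariant probability measure; (4) $\mathcal{T}$ is weak-Feller, and the set $\mathcal{G}$ of invariant occupation measures is weakly compact. If an exhaustive policy exists, then the set of all exhaustive policies is dense in $\Gamma_S$ with respect to the Young topology at input $\psi$.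
   Context: $\Gamma_S$ is the set of stationary Markov policies, identified with stochastic kernels $\gamma(du|x)$ from $\mathbb{X}$ to $\mathbb{U}$ (randomization allowed). Under $\gamma\in\Gamma_S$ the process $(x_t,u_t)$ is a time-homogeneous Markov chain with $u_t\sim\gamma(\cdot|x_t)$, $x_{t+1}\sim\mathcal{T}(\cdot|x_t,u_t)$. Total variation: $\|\mu-\nu\|_{TV}=2\sup_{B}|\mu(B)-\nu(B)|$, the supremum over Borel sets. Weak-Feller: $(x,u)\mapsto\int g(y)\mathcal{T}(dy|x,u)$ is continuous for every bounded continuous $g$ on $\mathbb{X}$. $\mathcal{G}:=\{\mu\in\mathcal{P}(\mathbb{X}\times\mathbb{U}):\ \mu(B\times\mathbb{U})=\int_{\mathbb{X}\times\mathbb{U}}\mu(dx,du)\,\mathcal{T}(B|x,u)\ \text{for all Borel }B\subseteq\mathbb{X}\}$. Young topology at input $\psi$: $\gamma_n\to\gamma$ in $\Gamma_S$ iff $\int g(x,u)\gamma_n(du|x)\psi(dx)\to\int g(x,u)\gamma(du|x)\psi(dx)$ for every bounded continuous $g:\mathbb{X}\times\mathbb{U}\to\mathbb{R}$. A policy $\gamma\in\Gamma_S$ is exhaustive if it induces an invariant probability measure $\bar\pi$ on $\mathbb{X}\times\mathbb{U}$ (for the chain $(x_t,u_t)$) such that $\bar\pi(B)>0$ for every non-empty open $B\subseteq\mathbb{X}\times\mathbb{U}$. *)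

theory Defs
  imports "HOL-Probability.Probability"
begin

section \<open>Stochastic kernels and stationary policies\<close>

text \<open>Measurability into the Giry space of probability measures is equivalent to the usual
  notion of stochastic kernel: each value is a Borel probability measure, and the measure of each
  Borel set depends measurably on the argument.\<close>

definition stochastic_kernels ::
    "('a::topological_space \<Rightarrow> 'b::topological_space measure) set" where
  "stochastic_kernels = borel \<rightarrow>\<^sub>M prob_algebra borel"

abbreviation (input) stationary_policies ::
    "('x::topological_space \<Rightarrow> 'u::topological_space measure) set" where
  "stationary_policies \<equiv> stochastic_kernels"

text \<open>The suprema below are suprema of reals; they are meaningful because both measures are
  finite in all uses.\<close>

definition tv_dist :: "'a::topological_space measure \<Rightarrow> 'a measure \<Rightarrow> real" where
  "tv_dist \<mu> \<nu> = 2 * (SUP B\<in>sets borel. \<bar>measure \<mu> B - measure \<nu> B\<bar>)"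

definition weak_feller ::
    "('x::topological_space \<times> 'u::topological_space \<Rightarrow> 'x measure) \<Rightarrow> bool" where
  "weak_feller T \<longleftrightarrow>
     (\<forall>g :: 'x \<Rightarrow>\<^sub>C real. continuous_on UNIV (\<lambda>z. \<integral>y. g y \<partial>T z))"

text \<open>Pointwise equicontinuity, with \<open>\<delta>\<close> allowed to depend on the base point \<open>x\<close>.\<close>

definition equicontinuous :: "('a::metric_space \<Rightarrow> real) set \<Rightarrow> bool" where
  "equicontinuous F \<longleftrightarrow>
     (\<forall>x. \<forall>\<epsilon>>0. \<exists>\<delta>>0. \<forall>f\<in>F. \<forall>y. dist y x < \<delta> \<longrightarrow> \<bar>f y - f x\<bar> < \<epsilon>)"

section \<open>The controlled chain\<close>

text \<open>One step of the chain of state-action pairs: from \<open>(x, u)\<close>, draw \<open>y\<close> from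
  \<open>T (x, u)\<close> and then \<open>v\<close> from \<open>\<gamma> y\<close>.\<close>

definition pair_kernel ::
    "('x::topological_space \<times> 'u::topological_space \<Rightarrow> 'x measure) \<Rightarrow> ('x \<Rightarrow> 'u measure)
      \<Rightarrow> 'x \<times> 'u \<Rightarrow> ('x \<times> 'u) measure" where
  "pair_kernel T \<gamma> z = T z \<bind> (\<lambda>y. \<gamma> y \<bind> (\<lambda>v. return borel (y, v)))"

definition invariant_prob ::
    "('x::topological_space \<times> 'u::topological_space \<Rightarrow> 'x measure) \<Rightarrow> ('x \<Rightarrow> 'u measure)
      \<Rightarrow> ('x \<times> 'u) measure \<Rightarrow> bool" where
  "invariant_prob T \<gamma> \<pi> \<longleftrightarrow>
     \<pi> \<in> space (prob_algebra borel) \<and> \<pi> \<bind> pair_kernel T \<gamma> = \<pi>"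

definition exhaustive_policies ::
    "('x::topological_space \<times> 'u::topological_space \<Rightarrow> 'x measure) \<Rightarrow> ('x \<Rightarrow> 'u measure) set" where
  "exhaustive_policies T =
     {\<gamma> \<in> stationary_policies. \<exists>\<pi>. invariant_prob T \<gamma> \<pi> \<and>
        (\<forall>B. open B \<and> B \<noteq> {} \<longrightarrow> measure \<pi> B > 0)}"

definition occupation_measures ::
    "('x::topological_space \<times> 'u::topological_space \<Rightarrow> 'x measure) \<Rightarrow> ('x \<times> 'u) measure set" where
  "occupation_measures T =
     {\<mu> \<in> space (prob_algebra borel).
        \<forall>B\<in>sets borel. measure \<mu> (B \<times> UNIV) = (\<integral>z. measure (T z) B \<partial>\<mu>)}"

section \<open>The weak topology and the Young topology\<close>

text \<open>Both are initial topologies with respect to integration against bounded continuous test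
  functions: the map sends an object to the family of all its test integrals, and the
  topology on families indexed by test functions is that of pointwise convergence. The limit
  lemmas below recover the usual descriptions of convergence.

  Policies that agree \<open>\<psi>\<close>-almost everywhere are not identified; they are topologically
  indistinguishable in the Young topology.\<close>

definition weak_topology :: "'a::topological_space measure topology" where
  "weak_topology =
     pullback_topology (space (prob_algebra borel)) (\<lambda>\<mu> (g :: 'a \<Rightarrow>\<^sub>C real). \<integral>z. g z \<partial>\<mu>) euclidean"

definition young_topology ::
    "'x::topological_space measure \<Rightarrow> ('x \<Rightarrow> 'u::topological_space measure) topology" where
  "young_topology \<psi> =
     pullback_topology stationary_policies
       (\<lambda>\<gamma> (g :: ('x \<times> 'u) \<Rightarrow>\<^sub>C real). \<integral>x. (\<integral>u. g (x, u) \<partial>\<gamma> x) \<partial>\<psi>) euclidean"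

lemma tendsto_fun_iff:
  fixes f :: "'i \<Rightarrow> 'a \<Rightarrow> 'b::topological_space"
  shows "(f \<longlongrightarrow> l) F \<longleftrightarrow> (\<forall>x. ((\<lambda>i. f i x) \<longlongrightarrow> l x) F)"
proof -
  have "(f \<longlongrightarrow> l) F \<longleftrightarrow> limitin (product_topology (\<lambda>_. euclidean) UNIV) f l F"
    by (simp add: euclidean_product_topology)
  then show ?thesis
    by (simp add: limitin_componentwise)
qed

lemma limitin_pullback_euclidean:
  fixes h :: "'a \<Rightarrow> 'b::topological_space"
  shows "limitin (pullback_topology A h euclidean) s l F \<longleftrightarrow>
    l \<in> A \<and> (\<forall>\<^sub>F n in F. s n \<in> A) \<and> ((\<lambda>n. h (s n)) \<longlongrightarrow> h l) F"
proof (cases "l \<in> A")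
  case False
  then show ?thesis
    by (simp add: limitin_def topspace_pullback_topology)
next
  case True
  have "limitin (pullback_topology A h euclidean) s l F \<longleftrightarrow>
      (\<forall>U. open U \<and> h l \<in> U \<longrightarrow> (\<forall>\<^sub>F n in F. h (s n) \<in> U \<and> s n \<in> A))"
  proof -
    have "limitin (pullback_topology A h euclidean) s l F \<longleftrightarrow>
        (\<forall>U. open U \<longrightarrow> l \<in> h -` U \<inter> A \<longrightarrow> (\<forall>\<^sub>F n in F. s n \<in> h -` U \<inter> A))"
      unfolding limitin_def topspace_pullback_topology openin_pullback_topology
      using True by (simp only: open_openin[symmetric] topspace_euclidean) blast
    then show ?thesis
      using True by (simp add: imp_conjL)
  qed
  also have "\<dots> \<longleftrightarrow> (\<forall>\<^sub>F n in F. s n \<in> A) \<and> ((\<lambda>n. h (s n)) \<longlongrightarrow> h l) F"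
    by (auto simp: tendsto_def eventually_conj_iff dest: spec[of _ UNIV])
  finally show ?thesis
    using True by simp
qed

lemma all_bcontfun_iff:
  "(\<forall>g :: 'a::topological_space \<Rightarrow>\<^sub>C real. P (apply_bcontfun g)) \<longleftrightarrow>
   (\<forall>g. continuous_on UNIV g \<and> bounded (range g) \<longrightarrow> P g)" (is "?L \<longleftrightarrow> ?R")
proof
  assume L: ?L
  show ?R
  proof (intro allI impI)
    fix g :: "'a \<Rightarrow> real"
    assume "continuous_on UNIV g \<and> bounded (range g)"
    then have "g \<in> bcontfun"
      by (simp add: bcontfun_def)
    then obtain g' where "g = apply_bcontfun g'"
      by (rule bcontfunE)
    with L show "P g"
      by simp
  qed
qed simp

lemma topspace_weak_topology: "topspace weak_topology = space (prob_algebra borel)"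
  by (simp add: weak_topology_def topspace_pullback_topology)

lemma topspace_young_topology: "topspace (young_topology \<psi>) = stationary_policies"
  by (simp add: young_topology_def topspace_pullback_topology)

lemma limitin_weak_topology:
  fixes \<mu> :: "'a::topological_space measure"
  shows "limitin weak_topology s \<mu> F \<longleftrightarrow>
    \<mu> \<in> space (prob_algebra borel) \<and> (\<forall>\<^sub>F n in F. s n \<in> space (prob_algebra borel)) \<and>
    (\<forall>g. continuous_on UNIV g \<and> bounded (range g) \<longrightarrow>
       ((\<lambda>n. \<integral>z. g z \<partial>s n) \<longlongrightarrow> (\<integral>z. (g z :: real) \<partial>\<mu>)) F)"
  unfolding weak_topology_def limitin_pullback_euclidean tendsto_fun_iff
  by (subst all_bcontfun_iff) simp

lemma limitin_young_topology:
  fixes \<gamma> :: "'x::topological_space \<Rightarrow> 'u::topological_space measure"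
  shows "limitin (young_topology \<psi>) s \<gamma> F \<longleftrightarrow>
    \<gamma> \<in> stationary_policies \<and> (\<forall>\<^sub>F n in F. s n \<in> stationary_policies) \<and>
    (\<forall>g. continuous_on UNIV g \<and> bounded (range g) \<longrightarrow>
       ((\<lambda>n. \<integral>x. (\<integral>u. g (x, u) \<partial>s n x) \<partial>\<psi>) \<longlongrightarrow> (\<integral>x. (\<integral>u. (g (x, u) :: real) \<partial>\<gamma> x) \<partial>\<psi>)) F)"
  unfolding young_topology_def limitin_pullback_euclidean tendsto_fun_iff
  by (subst all_bcontfun_iff) simp

end

theory Submission
  imports Defs
begin

text \<open>For a policy \<open>\<gamma>\<close> and an exhaustive policy \<open>\<gamma>\<^sub>0\<close> with invariant measure \<open>\<pi>\<^sub>0\<close>, every mixture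
  \<open>p \<gamma>\<^sub>0 + (1 - p) \<gamma>\<close> with \<open>p > 0\<close> is exhaustive. Indeed, let \<open>\<pi>\<close> be its invariant measure and \<open>K\<close>
  the pair kernel of \<open>\<gamma>\<^sub>0\<close>. Then \<open>\<pi> \<ge> p \<pi> K\<close>, so a \<open>\<pi>\<close>-null set is null for every \<open>\<pi> K\<^sup>k\<close>. By the
  Dobrushin contraction \<open>\<pi> K\<^sup>k\<close> converges to \<open>\<pi>\<^sub>0\<close> in total variation, so it is also \<open>\<pi>\<^sub>0\<close>-null and
  cannot be a non-empty open set. Letting \<open>p \<rightarrow> 0\<close> gives density. Dually, \<open>\<pi> K\<^sup>k\<close> is
  evaluated on an open set by integrating the iterates of \<open>K\<close> on its indicator, whose oscillation
  is at most \<open>\<beta>\<^sup>k\<close>.\<close>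

section \<open>Integration of bounded functions against probability kernels\<close>

lemma stochastic_kernels_space:
  assumes "\<gamma> \<in> stochastic_kernels"
  shows "\<gamma> x \<in> space (prob_algebra borel)"
  using measurable_space[of \<gamma> borel "prob_algebra borel" x] assms
  by (simp add: stochastic_kernels_def)

lemma integrable_bounded_prob_algebra:
  fixes g :: "'a::topological_space \<Rightarrow> real"
  assumes M: "M \<in> space (prob_algebra borel)" and g: "g \<in> borel_measurable borel"
    and b: "\<And>x. \<bar>g x\<bar> \<le> B"
  shows "integrable M g"
proof -
  interpret prob_space M
    using M by (simp add: space_prob_algebra)
  have "sets M = sets borel"
    using M by (simp add: space_prob_algebra)
  then have "g \<in> borel_measurable M"
    using g measurable_cong_sets by blast
  then show ?thesis
    using b by (intro integrable_const_bound[where B = B]) auto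
qed

lemma integral_bounds_prob_algebra:
  fixes g :: "'a::topological_space \<Rightarrow> real"
  assumes M: "M \<in> space (prob_algebra borel)" and g: "g \<in> borel_measurable borel"
    and b: "\<And>x. a \<le> g x" "\<And>x. g x \<le> b"
  shows "a \<le> (\<integral>x. g x \<partial>M)" "(\<integral>x. g x \<partial>M) \<le> b"
proof -
  interpret prob_space M
    using M by (simp add: space_prob_algebra)
  have "\<bar>g x\<bar> \<le> max \<bar>a\<bar> \<bar>b\<bar>" for x
    using b[of x] by linarith
  then have "integrable M g"
    by (rule integrable_bounded_prob_algebra[OF M g])
  then show "a \<le> (\<integral>x. g x \<partial>M)" "(\<integral>x. g x \<partial>M) \<le> b"
    using b by (auto intro!: integral_ge_const integral_le_const)
qed

text \<open>Fubini for the Giry bind. The source algebra \<open>A\<close> stays general because the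
  rule serves both a Bernoulli coin on \<open>count_space UNIV\<close> and Borel kernels.\<close>

lemma integral_bind_prob_algebra:
  fixes g :: "'b::topological_space \<Rightarrow> real"
  assumes M: "M \<in> space (prob_algebra A)" and K: "K \<in> A \<rightarrow>\<^sub>M prob_algebra borel"
    and g: "g \<in> borel_measurable borel" and b: "\<And>x. \<bar>g x\<bar> \<le> B"
  shows "(\<integral>x. g x \<partial>(M \<bind> K)) = (\<integral>y. (\<integral>x. g x \<partial>K y) \<partial>M)"
proof -
  interpret prob_space M
    using M by (simp add: space_prob_algebra)
  have s: "sets M = sets A"
    using M by (simp add: space_prob_algebra)
  have K': "K \<in> M \<rightarrow>\<^sub>M prob_algebra borel"
    using K measurable_cong_sets[OF s refl] by blast
  have K1: "K \<in> M \<rightarrow>\<^sub>M subprob_algebra borel"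
    by (rule measurable_prob_algebraD[OF K'])
  have e: "AE y in M. emeasure (K y) (space (K y)) \<le> ennreal 1"
    using measurable_space[OF K'] prob_space.emeasure_space_1
    by (intro AE_I2) (fastforce simp: space_prob_algebra)
  have fin: "finite_measure M"
    by (rule finite_measure_axioms)
  show ?thesis
    by (rule integral_bind[OF g _ K1 fin e]) (rule b)
qed

lemma measurable_integral_prob_algebra:
  fixes g :: "'b::topological_space \<Rightarrow> real"
  assumes "K \<in> A \<rightarrow>\<^sub>M prob_algebra borel" "g \<in> borel_measurable borel"
  shows "(\<lambda>y. \<integral>x. g x \<partial>K y) \<in> borel_measurable A"
  using integral_measurable_subprob_algebra[OF assms(2)] measurable_prob_algebraD[OF assms(1)]
  by (rule measurable_compose[rotated])

section \<open>Mixtures of measures and of policies\<close>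

text \<open>The convex combination \<open>p M + (1 - p) N\<close> for p in [0, 1], encoded as a coin
  toss followed by sampling. As a bind, it inherits the kernel property and the integral formula
  from the Giry monad.\<close>

definition mix :: "real \<Rightarrow> 'a measure \<Rightarrow> 'a measure \<Rightarrow> 'a measure" where
  "mix p M N = measure_pmf (bernoulli_pmf p) \<bind> (\<lambda>b. if b then M else N)"

lemma mix_kernel:
  assumes "\<gamma> \<in> stochastic_kernels" "\<gamma>' \<in> stochastic_kernels"
  shows "(\<lambda>x. mix p (\<gamma> x) (\<gamma>' x)) \<in> stochastic_kernels"
proof -
  have [measurable]: "\<gamma> \<in> borel \<rightarrow>\<^sub>M prob_algebra borel" "\<gamma>' \<in> borel \<rightarrow>\<^sub>M prob_algebra borel"
    using assms by (auto simp: stochastic_kernels_def)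
  have "measure_pmf (bernoulli_pmf p) \<in> space (prob_algebra (count_space UNIV))"
    by (simp add: space_prob_algebra measure_pmf.prob_space_axioms)
  then show ?thesis
    unfolding stochastic_kernels_def mix_def
    by (intro measurable_bind_prob_space2[where N = "count_space UNIV"] measurable_const) measurable
qed

lemma integral_mix:
  fixes g :: "'a::topological_space \<Rightarrow> real"
  assumes "M \<in> space (prob_algebra borel)" "N \<in> space (prob_algebra borel)"
    and g: "g \<in> borel_measurable borel" and b: "\<And>x. \<bar>g x\<bar> \<le> B"
    and p: "0 \<le> p" "p \<le> 1"
  shows "(\<integral>x. g x \<partial>mix p M N) = p * (\<integral>x. g x \<partial>M) + (1 - p) * (\<integral>x. g x \<partial>N)"
proof -
  have "measure_pmf (bernoulli_pmf p) \<in> space (prob_algebra (count_space UNIV))"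
    by (simp add: space_prob_algebra measure_pmf.prob_space_axioms)
  moreover have "(\<lambda>b. if b then M else N) \<in> count_space UNIV \<rightarrow>\<^sub>M prob_algebra borel"
    using assms by simp
  ultimately show ?thesis
    unfolding mix_def using g b p by (subst integral_bind_prob_algebra) (auto simp: algebra_simps)
qed

section \<open>The state-action chain and its dependence on the policy\<close>

lemma borel_measurable_Pair_right:
  fixes x :: "'a::second_countable_topology"
  shows "Pair x \<in> borel \<rightarrow>\<^sub>M (borel :: ('a \<times> 'b::second_countable_topology) measure)"
  by (simp add: borel_prod[symmetric])

text \<open>The second half of \<open>pair_kernel\<close>, which sees only the new state. Splitting
  it off leaves all dependence on the old pair in \<open>T z\<close>, where the contraction acts,
  and all dependence on the policy here.\<close>

definition lift_policy :: "('x::topological_space \<Rightarrow> 'u::topological_space measure)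
    \<Rightarrow> 'x \<Rightarrow> ('x \<times> 'u) measure" where
  "lift_policy \<gamma> y = \<gamma> y \<bind> (\<lambda>v. return borel (y, v))"

lemma lift_policy_kernel:
  fixes \<gamma> :: "'x::second_countable_topology \<Rightarrow> 'u::second_countable_topology measure"
  assumes "\<gamma> \<in> stochastic_kernels"
  shows "lift_policy \<gamma> \<in> stochastic_kernels"
proof -
  have [measurable]: "\<gamma> \<in> borel \<rightarrow>\<^sub>M prob_algebra borel"
    using assms by (simp add: stochastic_kernels_def)
  have "return borel \<in> borel \<rightarrow>\<^sub>M prob_algebra (borel :: ('x \<times> 'u) measure)"
    by (rule measurable_return_prob_space)
  then have "(\<lambda>(y, v). return borel (y, v)) \<in> (borel \<Otimes>\<^sub>M borel) \<rightarrow>\<^sub>M prob_algebra (borel :: ('x \<times> 'u) measure)"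
    by (simp add: borel_prod)
  then show ?thesis
    unfolding stochastic_kernels_def lift_policy_def
    by (intro measurable_bind_prob_space2[where N = borel]) measurable
qed

lemma integral_lift_policy:
  fixes \<gamma> :: "'x::second_countable_topology \<Rightarrow> 'u::second_countable_topology measure"
    and g :: "'x \<times> 'u \<Rightarrow> real"
  assumes \<gamma>: "\<gamma> \<in> stochastic_kernels"
    and g: "g \<in> borel_measurable borel" and b: "\<And>x. \<bar>g x\<bar> \<le> B"
  shows "(\<integral>z. g z \<partial>lift_policy \<gamma> y) = (\<integral>v. g (y, v) \<partial>\<gamma> y)"
proof -
  have "(\<lambda>v. return borel (y, v)) \<in> borel \<rightarrow>\<^sub>M prob_algebra (borel :: ('x \<times> 'u) measure)"
    by (rule measurable_compose[OF borel_measurable_Pair_right measurable_return_prob_space])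
  then show ?thesis
    unfolding lift_policy_def
    using integral_bind_prob_algebra[OF stochastic_kernels_space[OF \<gamma>] _ g b] g
    by (simp add: integral_return)
qed

lemma pair_kernel_eq_bind: "pair_kernel T \<gamma> z = T z \<bind> lift_policy \<gamma>"
  by (simp add: pair_kernel_def lift_policy_def[abs_def])

lemma pair_kernel_kernel:
  fixes T :: "'x::second_countable_topology \<times> 'u::second_countable_topology \<Rightarrow> 'x measure"
  assumes "T \<in> stochastic_kernels" "\<gamma> \<in> stochastic_kernels"
  shows "pair_kernel T \<gamma> \<in> stochastic_kernels"
  using assms(1) lift_policy_kernel[OF assms(2)]
  unfolding stochastic_kernels_def pair_kernel_eq_bind[abs_def]
  by (rule measurable_bind_prob_space)

lemma integral_pair_kernel:
  fixes T :: "'x::second_countable_topology \<times> 'u::second_countable_topology \<Rightarrow> 'x measure"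
    and g :: "'x \<times> 'u \<Rightarrow> real"
  assumes T: "T \<in> stochastic_kernels" and \<gamma>: "\<gamma> \<in> stochastic_kernels"
    and g: "g \<in> borel_measurable borel" and b: "\<And>x. \<bar>g x\<bar> \<le> B"
  shows "(\<integral>w. g w \<partial>pair_kernel T \<gamma> z) = (\<integral>y. (\<integral>w. g w \<partial>lift_policy \<gamma> y) \<partial>T z)"
  unfolding pair_kernel_eq_bind
  using integral_bind_prob_algebra[OF stochastic_kernels_space[OF T] _ g b]
    lift_policy_kernel[OF \<gamma>] by (simp add: stochastic_kernels_def)

text \<open>The policy enters only through the inner integral over actions, which is affine in the
  mixture. Boundedness of \<open>g\<close> makes both parts integrable, so the outer integral over
  \<open>T z\<close> splits as well.\<close>

lemma integral_pair_kernel_mix: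
  fixes T :: "'x::second_countable_topology \<times> 'u::second_countable_topology \<Rightarrow> 'x measure"
    and g :: "'x \<times> 'u \<Rightarrow> real"
  assumes T: "T \<in> stochastic_kernels" and \<gamma>: "\<gamma> \<in> stochastic_kernels" and \<gamma>': "\<gamma>' \<in> stochastic_kernels"
    and g: "g \<in> borel_measurable borel" and b: "\<And>x. \<bar>g x\<bar> \<le> B"
    and p: "0 \<le> p" "p \<le> 1"
  shows "(\<integral>w. g w \<partial>pair_kernel T (\<lambda>x. mix p (\<gamma> x) (\<gamma>' x)) z) =
    p * (\<integral>w. g w \<partial>pair_kernel T \<gamma> z) + (1 - p) * (\<integral>w. g w \<partial>pair_kernel T \<gamma>' z)"
proof -
  have int: "integrable (T z) (\<lambda>y. \<integral>w. g w \<partial>lift_policy \<delta> y)" if \<delta>: "\<delta> \<in> stochastic_kernels" for \<delta>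
  proof (rule integrable_bounded_prob_algebra[OF stochastic_kernels_space[OF T]])
    show "(\<lambda>y. \<integral>w. g w \<partial>lift_policy \<delta> y) \<in> borel_measurable borel"
      using lift_policy_kernel[OF \<delta>] g
      by (auto simp: stochastic_kernels_def intro: measurable_integral_prob_algebra)
    show "\<bar>\<integral>w. g w \<partial>lift_policy \<delta> y\<bar> \<le> B" for y
      using integral_bounds_prob_algebra[OF stochastic_kernels_space[OF lift_policy_kernel[OF \<delta>]] g,
          of "-B" B y] b by (simp add: abs_le_iff minus_le_iff)
  qed
  note section_meas = measurable_compose[OF borel_measurable_Pair_right g]
  have "(\<integral>w. g w \<partial>lift_policy (\<lambda>x. mix p (\<gamma> x) (\<gamma>' x)) y) =
      p * (\<integral>w. g w \<partial>lift_policy \<gamma> y) + (1 - p) * (\<integral>w. g w \<partial>lift_policy \<gamma>' y)" for y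
    using integral_mix[OF stochastic_kernels_space[OF \<gamma>] stochastic_kernels_space[OF \<gamma>'] section_meas b p]
    by (simp add: integral_lift_policy[OF _ g b] \<gamma> \<gamma>' mix_kernel)
  then show ?thesis
    using int[OF \<gamma>] int[OF \<gamma>']
    by (simp add: integral_pair_kernel[OF T _ g b] \<gamma> \<gamma>' mix_kernel)
qed

section \<open>Total variation and oscillation of integrals\<close>

lemma abs_measure_diff_le_1:
  assumes "prob_space M" "prob_space N"
  shows "\<bar>measure M B - measure N B\<bar> \<le> 1"
  using prob_space.prob_le_1[OF assms(1), of B] prob_space.prob_le_1[OF assms(2), of B]
    measure_nonneg[of M B] measure_nonneg[of N B] by linarith

lemma measure_diff_le_tv_dist:
  assumes "prob_space M" "prob_space N" "A \<in> sets borel"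
  shows "2 * \<bar>measure M A - measure N A\<bar> \<le> tv_dist M N"
proof -
  \<comment> \<open>A supremum of reals dominates its members only for a family bounded above; the
    bound 1 provides this.\<close>
  have "bdd_above ((\<lambda>B. \<bar>measure M B - measure N B\<bar>) ` sets borel)"
    using abs_measure_diff_le_1[OF assms(1,2)] by (intro bdd_aboveI2[where M = 1])
  then show ?thesis
    using cSUP_upper[OF assms(3)] by (simp add: tv_dist_def)
qed

lemma tv_dist_le_2:
  assumes "prob_space M" "prob_space N"
  shows "tv_dist M N \<le> 2"
proof -
  have "(SUP B\<in>sets borel. \<bar>measure M B - measure N B\<bar>) \<le> 1"
    using abs_measure_diff_le_1[OF assms] by (intro cSUP_least) auto
  then show ?thesis
    by (simp add: tv_dist_def)
qed

text \<open>The set where \<open>G\<close> is at most \<open>F\<close> is a positive Hahn set for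
  the difference of the two measures. Replacing \<open>h - a\<close> by \<open>b - a\<close> on this
  set and by 0 off it can only increase the difference of integrals, which then becomes
  \<open>b - a\<close> times a difference of measures of one set. This turns a setwise bound into a
  bound on functions with the same constant \<beta>.\<close>

lemma integral_diff_le_of_measure_diff_le:
  fixes F G h :: "'a \<Rightarrow> real"
  assumes F [measurable]: "F \<in> borel_measurable M" and F0: "\<And>y. 0 \<le> F y"
    and G [measurable]: "G \<in> borel_measurable M" and G0: "\<And>y. 0 \<le> G y"
    and pF: "prob_space (density M F)" and pG: "prob_space (density M G)"
    and \<beta>: "\<And>A. A \<in> sets M \<Longrightarrow> \<bar>measure (density M F) A - measure (density M G) A\<bar> \<le> \<beta>"
    and h [measurable]: "h \<in> borel_measurable M" and a: "\<And>y. a \<le> h y" and b: "\<And>y. h y \<le> b"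
  shows "(\<integral>y. h y \<partial>density M F) - (\<integral>y. h y \<partial>density M G) \<le> \<beta> * (b - a)"
proof -
  define A where "A = {y \<in> space M. G y \<le> F y}"
  have A [measurable]: "A \<in> sets M"
    unfolding A_def by measurable
  have "a \<le> b"
    using a b order_trans by blast
  interpret F: prob_space "density M F" by (rule pF)
  interpret G: prob_space "density M G" by (rule pG)
  have bd: "\<bar>h y\<bar> \<le> max \<bar>a\<bar> \<bar>b\<bar>" for y
    using a[of y] b[of y] by linarith
  have iF: "integrable (density M F) h"
    using bd by (intro F.integrable_const_bound[where B = "max \<bar>a\<bar> \<bar>b\<bar>"]) auto
  have iG: "integrable (density M G) h"
    using bd by (intro G.integrable_const_bound[where B = "max \<bar>a\<bar> \<bar>b\<bar>"]) auto
  let ?k = "\<lambda>y. h y - a" and ?l = "\<lambda>y. (b - a) * indicator A y"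
  have l: "integrable (density M F) ?l" "integrable (density M G) ?l"
    by (auto intro!: integrable_mult_right integrable_real_indicator F.emeasure_finite G.emeasure_finite
        simp: less_top[symmetric])
  have k: "integrable (density M F) ?k" "integrable (density M G) ?k"
    using iF iG by auto
  have integrable_M: "integrable M (\<lambda>y. P y * q y)"
    if "integrable (density M P) q" "P \<in> borel_measurable M" "q \<in> borel_measurable M" "\<And>y. 0 \<le> P y"
    for P q :: "'a \<Rightarrow> real"
    using that by (simp add: integrable_real_density)
  have kM: "integrable M (\<lambda>y. F y * ?k y)" "integrable M (\<lambda>y. G y * ?k y)"
    by (intro integrable_M k F G F0 G0; measurable)+
  have lM: "integrable M (\<lambda>y. F y * ?l y)" "integrable M (\<lambda>y. G y * ?l y)"
    by (intro integrable_M l F G F0 G0; measurable)+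
  \<comment> \<open>Both measures have mass one, so shifting by \<open>a\<close> cancels; afterwards
    the integrand takes values in [0, b - a].\<close>
  have "(\<integral>y. h y \<partial>density M F) - (\<integral>y. h y \<partial>density M G) =
      (\<integral>y. ?k y \<partial>density M F) - (\<integral>y. ?k y \<partial>density M G)"
    using iF iG F.prob_space G.prob_space by simp
  also have "\<dots> = (\<integral>y. F y * ?k y \<partial>M) - (\<integral>y. G y * ?k y \<partial>M)"
    using F0 G0 by (simp add: integral_density)
  also have "\<dots> = (\<integral>y. F y * ?k y - G y * ?k y \<partial>M)"
    using kM by simp
  also have "\<dots> \<le> (\<integral>y. F y * ?l y - G y * ?l y \<partial>M)"
  proof (rule integral_mono)
    fix y assume y: "y \<in> space M"
    show "F y * ?k y - G y * ?k y \<le> F y * ?l y - G y * ?l y"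
    proof (cases "y \<in> A")
      case True
      then have "(F y - G y) * ?k y \<le> (F y - G y) * (b - a)"
        using b[of y] by (intro mult_left_mono) (auto simp: A_def)
      with True show ?thesis
        by (simp add: algebra_simps)
    next
      case False
      then have "(F y - G y) * ?k y \<le> 0"
        using a[of y] y by (intro mult_nonpos_nonneg) (auto simp: A_def)
      with False show ?thesis
        by (simp add: algebra_simps)
    qed
  qed (use kM lM in auto)
  also have "\<dots> = (\<integral>y. F y * ?l y \<partial>M) - (\<integral>y. G y * ?l y \<partial>M)"
    using lM by simp
  also have "\<dots> = (\<integral>y. ?l y \<partial>density M F) - (\<integral>y. ?l y \<partial>density M G)"
    using F0 G0 by (subst (1 2) integral_real_density) auto
  also have "\<dots> = (b - a) * (measure (density M F) A - measure (density M G) A)"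
    by (subst right_diff_distrib) simp
  also have "\<dots> \<le> (b - a) * \<beta>"
    using \<beta>[OF A] \<open>a \<le> b\<close> by (intro mult_left_mono) auto
  finally show ?thesis
    by (simp add: mult.commute)
qed

text \<open>For fixed \<open>y\<close>, the function is at most \<open>g y + c\<close>, hence so is
  its integral against \<open>M\<close>. Read as a lower bound on \<open>g y\<close>, this is then
  integrated in \<open>y\<close> against \<open>N\<close>.\<close>

lemma integral_diff_le_oscillation:
  fixes g :: "'a::topological_space \<Rightarrow> real"
  assumes M: "M \<in> space (prob_algebra borel)" and N: "N \<in> space (prob_algebra borel)"
    and g: "g \<in> borel_measurable borel" and b: "\<And>x. \<bar>g x\<bar> \<le> B"
    and c: "\<And>x y. g x - g y \<le> c"
  shows "(\<integral>x. g x \<partial>M) - (\<integral>x. g x \<partial>N) \<le> c"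
proof -
  have b': "- B \<le> g x" "g x \<le> B" for x
    using b[of x] by linarith+
  have "(\<integral>x. g x \<partial>M) - c \<le> g y" for y
    using integral_bounds_prob_algebra(2)[OF M g b'(1), of "g y + c"] c[of _ y]
    by (simp add: diff_le_eq add.commute)
  then show ?thesis
    using integral_bounds_prob_algebra(1)[OF N g _ b'(2), of "(\<integral>x. g x \<partial>M) - c"] by simp
qed

section \<open>Exhaustiveness of mixtures with an exhaustive policy\<close>

text \<open>Here \<open>contract\<close> is the Dobrushin condition dualized to functions: averaging
  under \<open>T\<close> shrinks the length of an enclosing interval by the factor \<beta>. The
  argument follows the iterates of \<open>K\<close> on the indicator of an open set.\<close>

lemma exhaustive_policies_mix:
  fixes T :: "'x::second_countable_topology \<times> 'u::second_countable_topology \<Rightarrow> 'x measure"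
    and \<beta> :: real
  assumes T: "T \<in> stochastic_kernels"
    and \<beta>: "0 \<le> \<beta>" "\<beta> < 1"
    and contract: "\<And>h a b z z'. h \<in> borel_measurable borel \<Longrightarrow> (\<And>y. a \<le> h y) \<Longrightarrow> (\<And>y. h y \<le> b)
      \<Longrightarrow> (\<integral>y. h y \<partial>T z) - (\<integral>y. h y \<partial>T z') \<le> \<beta> * (b - a)"
    and \<gamma>\<^sub>0: "\<gamma>\<^sub>0 \<in> exhaustive_policies T" and \<gamma>: "\<gamma> \<in> stationary_policies"
    and p: "0 < p" "p \<le> 1"
    and inv: "invariant_prob T (\<lambda>x. mix p (\<gamma>\<^sub>0 x) (\<gamma> x)) \<pi>"
  shows "(\<lambda>x. mix p (\<gamma>\<^sub>0 x) (\<gamma> x)) \<in> exhaustive_policies T"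
proof -
  let ?\<delta> = "\<lambda>x. mix p (\<gamma>\<^sub>0 x) (\<gamma> x)"
  from \<gamma>\<^sub>0 obtain \<pi>\<^sub>0 where \<gamma>\<^sub>0_kernel: "\<gamma>\<^sub>0 \<in> stochastic_kernels"
    and inv\<^sub>0: "invariant_prob T \<gamma>\<^sub>0 \<pi>\<^sub>0" and pos: "\<And>B. open B \<Longrightarrow> B \<noteq> {} \<Longrightarrow> 0 < measure \<pi>\<^sub>0 B"
    by (auto simp: exhaustive_policies_def)
  have \<delta>: "?\<delta> \<in> stochastic_kernels"
    by (rule mix_kernel[OF \<gamma>\<^sub>0_kernel \<gamma>])
  have prob: "\<pi> \<in> space (prob_algebra borel)" "\<pi>\<^sub>0 \<in> space (prob_algebra borel)"
    using inv inv\<^sub>0 by (auto simp: invariant_prob_def)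
  define K where "K g z = (\<integral>w. g w \<partial>pair_kernel T \<gamma>\<^sub>0 z)" for g :: "'x \<times> 'u \<Rightarrow> real" and z
  have kernel_meas: "(\<lambda>z. \<integral>w. g w \<partial>pair_kernel T \<eta> z) \<in> borel_measurable borel"
    if "\<eta> \<in> stochastic_kernels" "g \<in> borel_measurable borel" for \<eta> and g :: "'x \<times> 'u \<Rightarrow> real"
    using pair_kernel_kernel[OF T that(1)] that(2)
    by (auto simp: stochastic_kernels_def intro: measurable_integral_prob_algebra)
  have kernel_bounds: "0 \<le> (\<integral>w. g w \<partial>pair_kernel T \<eta> z)" "(\<integral>w. g w \<partial>pair_kernel T \<eta> z) \<le> 1"
    if "\<eta> \<in> stochastic_kernels" "g \<in> borel_measurable borel" "\<And>w. 0 \<le> g w" "\<And>w. g w \<le> 1"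
    for \<eta> z and g :: "'x \<times> 'u \<Rightarrow> real"
    using integral_bounds_prob_algebra[OF stochastic_kernels_space[OF pair_kernel_kernel[OF T that(1)]] that(2-4)]
    by auto
  have integral_inv: "(\<integral>z. (\<integral>w. g w \<partial>pair_kernel T \<eta> z) \<partial>\<mu>) = (\<integral>w. g w \<partial>\<mu>)"
    if \<eta>: "\<eta> \<in> stochastic_kernels" "invariant_prob T \<eta> \<mu>"
      and g: "g \<in> borel_measurable borel" "\<And>w. \<bar>g w\<bar> \<le> 1"
    for \<eta> \<mu> and g :: "'x \<times> 'u \<Rightarrow> real"
    using integral_bind_prob_algebra[OF _ _ g, of \<mu> borel "pair_kernel T \<eta>"]
      pair_kernel_kernel[OF T \<eta>(1)] \<eta>(2)
    by (simp add: invariant_prob_def stochastic_kernels_def)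
  \<comment> \<open>This is the domination of \<pi> K by \<pi> / p, tested on \<open>g\<close>.
    Invariance under the mixture writes 0 as \<open>p\<close> times this integral plus a
    non-negative term for \<gamma>, and \<open>p\<close> is positive.\<close>
  have null_step: "(\<integral>z. K g z \<partial>\<pi>) = 0"
    if g: "g \<in> borel_measurable borel" "\<And>w. 0 \<le> g w" "\<And>w. g w \<le> 1" and 0: "(\<integral>w. g w \<partial>\<pi>) = 0"
    for g
  proof -
    let ?H = "\<lambda>z. \<integral>w. g w \<partial>pair_kernel T \<gamma> z"
    have b: "\<bar>g w\<bar> \<le> 1" for w
      using g(2,3) by simp
    have K: "K g \<in> borel_measurable borel" "\<And>z. 0 \<le> K g z" "\<And>z. K g z \<le> 1"
      using kernel_meas[OF \<gamma>\<^sub>0_kernel g(1)] kernel_bounds[OF \<gamma>\<^sub>0_kernel g] by (auto simp: K_def[abs_def])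
    have H: "?H \<in> borel_measurable borel" "\<And>z. 0 \<le> ?H z" "\<And>z. ?H z \<le> 1"
      using kernel_meas[OF \<gamma> g(1)] kernel_bounds[OF \<gamma> g] by auto
    have int: "integrable \<pi> (K g)" "integrable \<pi> ?H"
      using K H by (auto intro!: integrable_bounded_prob_algebra[OF prob(1), where B = 1])
    have "0 = (\<integral>z. p * K g z + (1 - p) * ?H z \<partial>\<pi>)"
      using integral_inv[OF \<delta> inv g(1) b] p 0
      by (simp add: integral_pair_kernel_mix[OF T \<gamma>\<^sub>0_kernel \<gamma> g(1) b] K_def)
    also have "\<dots> = p * (\<integral>z. K g z \<partial>\<pi>) + (1 - p) * (\<integral>z. ?H z \<partial>\<pi>)"
      using int by simp
    finally have "p * (\<integral>z. K g z \<partial>\<pi>) + (1 - p) * (\<integral>z. ?H z \<partial>\<pi>) = 0"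
      by simp
    moreover have "0 \<le> (1 - p) * (\<integral>z. ?H z \<partial>\<pi>)" "0 \<le> p * (\<integral>z. K g z \<partial>\<pi>)"
      using p K H by (auto intro!: mult_nonneg_nonneg integral_nonneg)
    ultimately have "p * (\<integral>z. K g z \<partial>\<pi>) = 0"
      by linarith
    then show ?thesis
      using p by simp
  qed
  \<comment> \<open>Averaging over the action under \<open>\<gamma>\<^sub>0\<close> does not
    increase the oscillation; averaging over the next state under \<open>T\<close> then contracts
    it.\<close>
  have osc_step: "K g z - K g z' \<le> \<beta> * c"
    if g: "g \<in> borel_measurable borel" "\<And>w. \<bar>g w\<bar> \<le> 1" and c: "\<And>w w'. g w - g w' \<le> c" for g c z z'
  proof -
    define h where "h y = (\<integral>w. g w \<partial>lift_policy \<gamma>\<^sub>0 y)" for y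
    have L: "lift_policy \<gamma>\<^sub>0 y \<in> space (prob_algebra borel)" for y
      by (rule stochastic_kernels_space[OF lift_policy_kernel[OF \<gamma>\<^sub>0_kernel]])
    have h: "h \<in> borel_measurable borel"
      using lift_policy_kernel[OF \<gamma>\<^sub>0_kernel] g(1) unfolding h_def[abs_def]
      by (auto simp: stochastic_kernels_def intro: measurable_integral_prob_algebra)
    have g': "- 1 \<le> g w" "g w \<le> 1" for w
      using g(2)[of w] by linarith+
    have "- 1 \<le> h y" for y
      unfolding h_def by (rule integral_bounds_prob_algebra(1)[OF L g(1) g'])
    then have bdd: "bdd_below (range h)"
      by (rule bdd_belowI2)
    have diff: "h y - h y' \<le> c" for y y'
      unfolding h_def by (rule integral_diff_le_oscillation[OF L L g c])
    \<comment> \<open>The contraction wants an enclosing interval rather than pairwise differences.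
      The infimum of \<open>h\<close> as left end gives one of length exactly
      \<open>c\<close>.\<close>
    have "h y - c \<le> (INF y. h y)" for y
      using diff[of y] by (intro cINF_greatest) (auto simp: algebra_simps)
    then have upper: "h y \<le> (INF y. h y) + c" for y
      by (simp add: algebra_simps)
    show ?thesis
      using contract[OF h cINF_lower[OF bdd UNIV_I] upper, of z z']
      by (simp add: K_def integral_pair_kernel[OF T \<gamma>\<^sub>0_kernel g] h_def)
  qed
  have "0 < measure \<pi> B" if B: "open B" "B \<noteq> {}" for B
  proof (rule ccontr)
    assume "\<not> 0 < measure \<pi> B"
    then have "measure \<pi> B = 0"
      using measure_nonneg[of \<pi> B] by linarith
    \<comment> \<open>The integral of an indicator is the measure of the intersection with the
      space, which here is the whole type.\<close>
    have sB: "B \<inter> space \<mu> = B" if "\<mu> \<in> space (prob_algebra borel)" for \<mu>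
      using sets_eq_imp_space_eq[of \<mu> borel] that by (simp add: space_prob_algebra)
    define g where "g k = (K ^^ k) (indicator B)" for k
    have g0: "g 0 = indicator B" and gSuc: "g (Suc k) = K (g k)" for k
      by (simp_all add: g_def)
    \<comment> \<open>The integrals against \<pi> and \<open>\<pi>\<^sub>0\<close> stay frozen, by
      \<open>null_step\<close> and by invariance of \<open>\<pi>\<^sub>0\<close>, while the
      oscillation decays. At k = 0 an indicator oscillates by at most 1, the zeroth power of
      \<beta>.\<close>
    have main: "g k \<in> borel_measurable borel \<and> (\<forall>w. 0 \<le> g k w \<and> g k w \<le> 1) \<and>
        (\<integral>w. g k w \<partial>\<pi>) = 0 \<and> (\<integral>w. g k w \<partial>\<pi>\<^sub>0) = measure \<pi>\<^sub>0 B \<and> (\<forall>w w'. g k w - g k w' \<le> \<beta> ^ k)" for k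
    proof (induction k)
      case 0
      show ?case
        using B \<open>measure \<pi> B = 0\<close> sB[OF prob(1)] sB[OF prob(2)]
        by (simp add: g0 split: split_indicator)
    next
      case (Suc k)
      then have g: "g k \<in> borel_measurable borel" "\<And>w. 0 \<le> g k w" "\<And>w. g k w \<le> 1"
        and abs: "\<And>w. \<bar>g k w\<bar> \<le> 1"
        and osc: "\<And>w w'. g k w - g k w' \<le> \<beta> ^ k"
        by auto
      have "K (g k) \<in> borel_measurable borel" "\<And>z. 0 \<le> K (g k) z" "\<And>z. K (g k) z \<le> 1"
        using kernel_meas[OF \<gamma>\<^sub>0_kernel g(1)] kernel_bounds[OF \<gamma>\<^sub>0_kernel g] by (auto simp: K_def[abs_def])
      moreover have "(\<integral>w. K (g k) w \<partial>\<pi>) = 0"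
        using Suc by (intro null_step g) auto
      moreover have "(\<integral>w. K (g k) w \<partial>\<pi>\<^sub>0) = measure \<pi>\<^sub>0 B"
        using Suc integral_inv[OF \<gamma>\<^sub>0_kernel inv\<^sub>0 g(1) abs] by (simp add: K_def)
      ultimately show ?case
        using osc_step[OF g(1) abs osc] by (simp add: gSuc)
    qed
    \<comment> \<open>The left side is the difference of the integrals of \<open>g k\<close> against
      \<open>\<pi>\<^sub>0\<close> and \<pi>, the latter being 0.\<close>
    have "measure \<pi>\<^sub>0 B \<le> \<beta> ^ k" for k
      using integral_diff_le_oscillation[OF prob(2,1), of "g k" 1 "\<beta> ^ k"] main[of k] by simp
    moreover have "(\<lambda>k. \<beta> ^ k) \<longlonglongrightarrow> 0"
      using \<beta> by (intro LIMSEQ_power_zero) simp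
    ultimately have "measure \<pi>\<^sub>0 B \<le> 0"
      by (intro LIMSEQ_le_const) auto
    with pos[OF B] show False
      by simp
  qed
  with \<delta> inv show ?thesis
    unfolding exhaustive_policies_def by blast
qed

section \<open>Young convergence of mixtures and density\<close>

text \<open>Each test integral is affine in the mixing weight, so it tends to its value at weight 0,
  which belongs to \<gamma>.\<close>

lemma limitin_young_topology_mix:
  fixes \<gamma> :: "'x::second_countable_topology \<Rightarrow> 'u::second_countable_topology measure"
  assumes \<gamma>: "\<gamma> \<in> stationary_policies" and \<gamma>': "\<gamma>' \<in> stationary_policies"
    and \<psi>: "\<psi> \<in> space (prob_algebra borel)"
    and p: "\<And>n. 0 \<le> p n" "\<And>n. p n \<le> 1" "p \<longlonglongrightarrow> 0"
  shows "limitin (young_topology \<psi>) (\<lambda>n x. mix (p n) (\<gamma>' x) (\<gamma> x)) \<gamma> sequentially"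
  unfolding limitin_young_topology
proof (intro conjI allI impI always_eventually)
  show "\<gamma> \<in> stationary_policies" by (rule \<gamma>)
  show "(\<lambda>x. mix (p n) (\<gamma>' x) (\<gamma> x)) \<in> stationary_policies" for n
    by (rule mix_kernel[OF \<gamma>' \<gamma>])
  fix g :: "'x \<times> 'u \<Rightarrow> real"
  assume g: "continuous_on UNIV g \<and> bounded (range g)"
  then obtain B where b: "\<And>z. \<bar>g z\<bar> \<le> B"
    by (auto simp: bounded_iff)
  have g_meas: "g \<in> borel_measurable borel"
    using g by (simp add: borel_measurable_continuous_onI)
  note section_meas = measurable_compose[OF borel_measurable_Pair_right g_meas]
  have int: "integrable \<psi> (\<lambda>x. \<integral>u. g (x, u) \<partial>\<eta> x)" if \<eta>: "\<eta> \<in> stochastic_kernels" for \<eta>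
  proof (rule integrable_bounded_prob_algebra[OF \<psi>])
    \<comment> \<open>The integrand depends on \<open>x\<close> as well as the measure does. Passing
      to the lifted kernel makes the integrand fixed, so kernel measurability applies.\<close>
    have "(\<lambda>x. \<integral>z. g z \<partial>lift_policy \<eta> x) \<in> borel_measurable borel"
      using lift_policy_kernel[OF \<eta>] g_meas
      by (auto simp: stochastic_kernels_def intro: measurable_integral_prob_algebra)
    then show "(\<lambda>x. \<integral>u. g (x, u) \<partial>\<eta> x) \<in> borel_measurable borel"
      by (simp add: integral_lift_policy[OF \<eta> g_meas b])
    show "\<bar>\<integral>u. g (x, u) \<partial>\<eta> x\<bar> \<le> B" for x
      using integral_bounds_prob_algebra[OF stochastic_kernels_space[OF \<eta>] section_meas, of "-B" x B] b
      by (simp add: abs_le_iff minus_le_iff)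
  qed
  let ?I = "\<lambda>\<eta>. \<integral>x. (\<integral>u. g (x, u) \<partial>\<eta> x) \<partial>\<psi>"
  have "?I (\<lambda>x. mix (p n) (\<gamma>' x) (\<gamma> x)) = p n * ?I \<gamma>' + (1 - p n) * ?I \<gamma>" for n
    using int[OF \<gamma>] int[OF \<gamma>']
    by (simp add: integral_mix[OF stochastic_kernels_space[OF \<gamma>'] stochastic_kernels_space[OF \<gamma>] section_meas b p(1,2)])
  moreover have "(\<lambda>n. p n * ?I \<gamma>' + (1 - p n) * ?I \<gamma>) \<longlonglongrightarrow> 0 * ?I \<gamma>' + (1 - 0) * ?I \<gamma>"
    by (intro tendsto_intros p)
  ultimately show "(\<lambda>n. ?I (\<lambda>x. mix (p n) (\<gamma>' x) (\<gamma> x))) \<longlonglongrightarrow> ?I \<gamma>"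
    by simp
qed

theorem theorem3p6:
  fixes T :: "(real ^ 'n) \<times> 'u::polish_space \<Rightarrow> (real ^ 'n) measure"
    and \<psi> :: "(real ^ 'n) measure"
    and f :: "(real ^ 'n) \<times> 'u \<Rightarrow> real ^ 'n \<Rightarrow> real"
    and \<beta> :: real
  assumes compact_U: "compact (UNIV :: 'u set)"
    and kernel: "T \<in> stochastic_kernels"
    and beta: "0 \<le> \<beta>" "\<beta> < 1"
    and contraction: "(SUP (z, z')\<in>UNIV. tv_dist (T z) (T z')) \<le> 2 * \<beta>"
    and psi: "\<psi> \<in> space (prob_algebra borel)"
    and f_meas: "\<And>z. f z \<in> borel_measurable borel"
    and f_nonneg: "\<And>z y. 0 \<le> f z y"
    and T_density: "\<And>z. T z = density \<psi> (\<lambda>y. ennreal (f z y))"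
    and f_bounded: "\<exists>C. \<forall>z y. \<bar>f z y\<bar> \<le> C"
    and f_equicont: "equicontinuous (range f)"
    and unique_inv: "\<And>\<gamma>. \<gamma> \<in> stationary_policies \<Longrightarrow> \<exists>!\<pi>. invariant_prob T \<gamma> \<pi>"
    and feller: "weak_feller T"
    and G_compact: "compactin weak_topology (occupation_measures T)"
    and ex_exhaustive: "exhaustive_policies T \<noteq> {}"
  shows "young_topology \<psi> closure_of exhaustive_policies T = stationary_policies"
proof -
  have prob: "prob_space (T z)" for z
    using stochastic_kernels_space[OF kernel, of z] by (simp add: space_prob_algebra)
  \<comment> \<open>Boundedness is what allows the bound on the real supremum to be read off for
    each pair.\<close>
  have "bdd_above (range (\<lambda>(z, z'). tv_dist (T z) (T z')))"
    using tv_dist_le_2[OF prob prob] by (intro bdd_aboveI2[where M = 2]) auto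
  then have tv: "tv_dist (T z) (T z') \<le> 2 * \<beta>" for z z'
    using cSUP_upper[of "(z, z')" UNIV "\<lambda>(z, z'). tv_dist (T z) (T z')"] contraction by simp
  have sets_\<psi>: "sets \<psi> = sets borel"
    using psi by (simp add: space_prob_algebra)
  have meas_\<psi>: "borel_measurable \<psi> = (borel_measurable borel :: (real ^ 'n \<Rightarrow> real) set)"
    by (rule measurable_cong_sets[OF sets_\<psi> refl])
  \<comment> \<open>The factor 2 in \<open>tv_dist\<close> cancels against
    \<open>2 * \<beta>\<close>, leaving setwise differences of at most \<beta>. The common reference
    measure \<psi> supplies the two densities.\<close>
  have contract: "(\<integral>y. h y \<partial>T z) - (\<integral>y. h y \<partial>T z') \<le> \<beta> * (b - a)"
    if h: "h \<in> borel_measurable borel" "\<And>y. a \<le> h y" "\<And>y. h y \<le> b" for h a b z z'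
    unfolding T_density
  proof (rule integral_diff_le_of_measure_diff_le)
    fix A assume "A \<in> sets \<psi>"
    then show "\<bar>measure (density \<psi> (f z)) A - measure (density \<psi> (f z')) A\<bar> \<le> \<beta>"
      using measure_diff_le_tv_dist[OF prob[of z] prob[of z'], of A] tv[of z z']
      by (simp add: sets_\<psi> T_density)
  qed (use h f_meas f_nonneg prob[of z] prob[of z'] in \<open>simp_all add: meas_\<psi> T_density\<close>)
  obtain \<gamma>\<^sub>0 where \<gamma>\<^sub>0: "\<gamma>\<^sub>0 \<in> exhaustive_policies T"
    using ex_exhaustive by blast
  then have \<gamma>\<^sub>0_kernel: "\<gamma>\<^sub>0 \<in> stationary_policies"
    by (simp add: exhaustive_policies_def)
  have "\<gamma> \<in> young_topology \<psi> closure_of exhaustive_policies T" if \<gamma>: "\<gamma> \<in> stationary_policies" for \<gamma>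
  proof -
    \<comment> \<open>The weights 1/(n+1) lie in (0, 1], as exhaustiveness of the mixture requires,
      and tend to 0, as convergence to \<gamma> requires.\<close>
    let ?\<delta> = "\<lambda>n x. mix (inverse (real (Suc n))) (\<gamma>\<^sub>0 x) (\<gamma> x)"
    have exh: "?\<delta> n \<in> exhaustive_policies T" for n
    proof -
      obtain \<pi> where "invariant_prob T (?\<delta> n) \<pi>"
        using unique_inv[OF mix_kernel[OF \<gamma>\<^sub>0_kernel \<gamma>]] by blast
      then show ?thesis
        by (intro exhaustive_policies_mix[OF kernel beta _ \<gamma>\<^sub>0 \<gamma>] contract)
          (assumption | simp add: inverse_le_1_iff)+
    qed
    have lim: "limitin (young_topology \<psi>) ?\<delta> \<gamma> sequentially"
      by (intro limitin_young_topology_mix \<gamma> \<gamma>\<^sub>0_kernel psi LIMSEQ_inverse_real_of_nat)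
        (simp_all add: inverse_le_1_iff)
    have sub: "exhaustive_policies T \<subseteq> topspace (young_topology \<psi>)"
      by (auto simp: topspace_young_topology exhaustive_policies_def)
    show ?thesis
    proof (rule limitin_closedin[OF lim])
      show "\<forall>\<^sub>F n in sequentially. ?\<delta> n \<in> young_topology \<psi> closure_of exhaustive_policies T"
        using closure_of_subset[OF sub] exh by (intro always_eventually) blast
    qed auto
  qed
  then show ?thesis
    using closure_of_subset_topspace[of "young_topology \<psi>" "exhaustive_policies T"]
    by (auto simp: topspace_young_topology)
qed

end
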